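(* Let $q$ be a prime power, let $P\subset\mathbb{R}^r$ be an $r$-dimensional convex lattice polytope ($r\ge 2$), let $M=\mathbb{Z}^r$, and let $\mathcal{C}_P$ be the toric code associated to $P$, i.e. the image of the evaluation map $\mathrm{ev}:\mathrm{H}^0(X_P,\mathcal{O}(D_P))\to(\mathbb{F}_q)^{\#T}$, $f\mapsto (f(t))_{t\in T}$, where $T=(\mathbb{F}_q^\ast)^r$. For every $u\in P\cap M$ write $u=c_u+b_u$ with $c_u\in H=\{0,\ldots,q-2\}^r$ and $b_u\in((q-1)\mathbb{Z})^r$, and let $\overline{P}=\{c_u \mid u\in P\cap M\}\subset M$. Then: (1) The kernel of $\mathrm{ev}$ is the $\mathbb{F}_q$-vector space generated by $$\{\chi^u-\chi^{u'} \mid u,u'\in P\cap M,\ c_u=c_{u'}\}.$$ (2) A basis of the code $\mathcal{C}_P$ is $$\{(\chi^{c_u}(t))_{t\in T}\mid u\in P\cap M\}=\{(\chi^{u}(t))_{t\in T}\mid u\in\overline{P}\},$$ and therefore the dimension of $\mathcal{C}_P$ is $k=\#\{c_u\mid u\in P\cap M\}=\#\overline{P}$.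
   Context: For $u=(u_1,\ldots,u_r)\in M=\mathbb{Z}^r$, $\chi^u=t_1^{u_1}\cdots t_r^{u_r}$ is the Laurent monomial over $\mathbb{F}_q$ with exponent $u$, also viewed as a function $T=(\mathbb{F}_q^\ast)^r\to\mathbb{F}_q^\ast$. A polytope here is the convex hull in $\mathbb{R}^r$ of a finite set of points of $M$. $X_P$ is the (refined, non-singular) toric variety over $\mathbb{F}_q$ associated to $P$ and $D_P$ the associated $T$-invariant Cartier divisor; the space of global sections $\mathrm{H}^0(X_P,\mathcal{O}(D_P))$ is the finite-dimensional $\mathbb{F}_q$-vector space of Laurent polynomials having $\{\chi^u\mid u\in P\cap M\}$ as a basis. The code $\mathcal{C}_P$ has length $n=\#T=(q-1)^r$. For each $u\in M$ the vectors $c_u\in H$ and $b_u\in((q-1)\mathbb{Z})^r$ with $u=c_u+b_u$ are uniquely determined (coordinatewise reduction modulo $q-1$). *)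

theory Defs
  imports "HOL-Analysis.Analysis" "HOL-Library.Poly_Mapping"
begin

text \<open>
  The finite field with \<open>q\<close> elements is a type \<open>'a :: {field, finite}\<close> with \<open>CARD('a) = q\<close>, and
  the dimension \<open>r\<close> is \<open>CARD('n)\<close>. The lattice \<open>M\<close> is the type \<open>int ^ 'n\<close>.
\<close>

definition lattice_embed :: "int ^ 'n \<Rightarrow> real ^ 'n" where
  "lattice_embed u = (\<chi> i. real_of_int (u $ i))"

definition lattice_points :: "(real ^ 'n) set \<Rightarrow> (int ^ 'n) set" where
  "lattice_points P = {u. lattice_embed u \<in> P}"

definition lattice_polytope :: "(real ^ 'n) set \<Rightarrow> bool" where
  "lattice_polytope P \<longleftrightarrow> (\<exists>V :: (int ^ 'n) set. finite V \<and> P = convex hull (lattice_embed ` V))"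

text \<open>
  The torus is the type \<open>'a nonzero ^ 'n\<close>, so that words of length \<open>#T\<close> over the field are vectors
  of type \<open>'a ^ ('a nonzero ^ 'n)\<close>.
\<close>

typedef (overloaded) 'a nonzero = "{x :: 'a :: zero_neq_one. x \<noteq> 0}"
  by (rule exI[of _ 1]) simp

instance nonzero :: ("{zero_neq_one, finite}") finite
proof
  have "inj (Rep_nonzero :: 'a nonzero \<Rightarrow> 'a)"
    by (simp add: inj_def Rep_nonzero_inject)
  then show "finite (UNIV :: 'a nonzero set)"
    by (rule finite_imageD[rotated]) simp
qed

lemma card_torus:
  "CARD('a :: {field, finite} nonzero ^ 'n :: finite) = (CARD('a) - 1) ^ CARD('n)"
proof -
  have "CARD('a nonzero) = card {x :: 'a. x \<noteq> 0}"
    by (rule type_definition.card[OF type_definition_nonzero])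
  also have "{x :: 'a. x \<noteq> 0} = UNIV - {0}" by auto
  finally show ?thesis by (simp add: CARD_vec card_Diff_singleton)
qed

type_synonym ('a, 'n) laurent = "(int ^ 'n) \<Rightarrow>\<^sub>0 'a"

definition lmonom :: "int ^ 'n \<Rightarrow> ('a :: field, 'n) laurent" where
  "lmonom u = Poly_Mapping.single u 1"

definition lscale :: "'a :: field \<Rightarrow> ('a, 'n) laurent \<Rightarrow> ('a, 'n) laurent" where
  "lscale c f = Poly_Mapping.map ((*) c) f"

lemma lookup_lscale [simp]: "Poly_Mapping.lookup (lscale c f) u = c * Poly_Mapping.lookup f u"
  by (simp add: lscale_def Poly_Mapping.map.rep_eq in_keys_iff when_def)

global_interpretation laurent: vector_space "lscale :: 'a :: field \<Rightarrow> ('a, 'n) laurent \<Rightarrow> _"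
  by unfold_locales (auto intro!: poly_mapping_eqI simp: lookup_add algebra_simps)

definition monom_at :: "int ^ 'n \<Rightarrow> 'a :: field nonzero ^ 'n :: finite \<Rightarrow> 'a" where
  "monom_at u t = (\<Prod>i\<in>UNIV. Rep_nonzero (t $ i) powi (u $ i))"

definition monom_word :: "int ^ 'n \<Rightarrow> 'a :: {field, finite} ^ ('a nonzero ^ 'n :: finite)" where
  "monom_word u = (\<chi> t. monom_at u t)"

definition ev :: "('a :: {field, finite}, 'n :: finite) laurent \<Rightarrow> 'a ^ ('a nonzero ^ 'n)" where
  "ev f = (\<chi> t. \<Sum>u\<in>Poly_Mapping.keys f. Poly_Mapping.lookup f u * monom_at u t)"

text \<open>
  The global sections of the line bundle of the divisor associated to \<open>P\<close> are identified with the
  Laurent polynomials spanned by the monomials whose exponents are lattice points of \<open>P\<close>. The toric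
  variety itself is not constructed.
\<close>

definition sections :: "(real ^ 'n) set \<Rightarrow> ('a :: field, 'n) laurent set" where
  "sections P = laurent.span (lmonom ` lattice_points P)"

lemma sections_eq:
  "(sections P :: ('a :: field, 'n :: finite) laurent set) = {f. Poly_Mapping.keys f \<subseteq> lattice_points P}"
proof (intro equalityI subsetI)
  fix f :: "('a, 'n) laurent"
  assume "f \<in> sections P"
  moreover have "laurent.subspace {f :: ('a, 'n) laurent. Poly_Mapping.keys f \<subseteq> lattice_points P}"
    by (rule laurent.subspaceI) (auto simp: in_keys_iff lookup_add subset_iff, metis add.right_neutral)
  moreover have "lmonom ` lattice_points P \<subseteq> {f :: ('a, 'n) laurent. Poly_Mapping.keys f \<subseteq> lattice_points P}"
    by (auto simp: lmonom_def)
  ultimately show "f \<in> {f. Poly_Mapping.keys f \<subseteq> lattice_points P}"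
    unfolding sections_def using laurent.span_minimal by blast
next
  fix f :: "('a, 'n) laurent"
  assume f: "f \<in> {f. Poly_Mapping.keys f \<subseteq> lattice_points P}"
  have "f = (\<Sum>u\<in>Poly_Mapping.keys f. lscale (Poly_Mapping.lookup f u) (lmonom u))"
    by (rule poly_mapping_eqI)
      (auto simp: lookup_sum lmonom_def lookup_single when_def in_keys_iff if_distrib sum.delta cong: if_cong)
  also have "\<dots> \<in> sections P"
    unfolding sections_def using f
    by (intro laurent.span_sum laurent.span_scale laurent.span_base) auto
  finally show "f \<in> sections P" .
qed

definition toric_code :: "(real ^ 'n) set \<Rightarrow> ('a :: {field, finite} ^ ('a nonzero ^ 'n :: finite)) set" where
  "toric_code P = ev ` sections P"

definition residue_box :: "nat \<Rightarrow> (int ^ 'n) set" where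
  "residue_box q = {c. \<forall>i. c $ i \<in> {0..int q - 2}}"

definition residue_rep :: "nat \<Rightarrow> int ^ 'n \<Rightarrow> int ^ 'n" where
  "residue_rep q u = (THE c. c \<in> residue_box q \<and> (\<exists>b. (\<forall>i. int q - 1 dvd b $ i) \<and> u = c + b))"

lemma residue_rep_unique:
  fixes u :: "int ^ 'n"
  assumes "q \<ge> 2"
  shows "c \<in> residue_box q \<and> (\<exists>b. (\<forall>i. int q - 1 dvd b $ i) \<and> u = c + b)
    \<longleftrightarrow> c = (\<chi> i. u $ i mod (int q - 1))"
proof
  assume "c \<in> residue_box q \<and> (\<exists>b. (\<forall>i. int q - 1 dvd b $ i) \<and> u = c + b)"
  then obtain b where c: "c \<in> residue_box q" and b: "\<And>i. int q - 1 dvd b $ i" and u: "u = c + b" by blast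
  show "c = (\<chi> i. u $ i mod (int q - 1))"
  proof (rule vec_eq_iff[THEN iffD2], rule allI)
    fix i
    have "c $ i mod (int q - 1) = c $ i"
      using c assms by (intro mod_pos_pos_trivial) (auto simp: residue_box_def dest: spec[of _ i])
    with b[of i] show "c $ i = (\<chi> i. u $ i mod (int q - 1)) $ i"
      by (auto simp: u elim!: dvdE)
  qed
next
  assume c: "c = (\<chi> i. u $ i mod (int q - 1))"
  have "0 \<le> u $ i mod (int q - 1)" "u $ i mod (int q - 1) \<le> int q - 2" for i
    using assms pos_mod_sign[of "int q - 1" "u $ i"] pos_mod_bound[of "int q - 1" "u $ i"] by linarith+
  then have "c \<in> residue_box q"
    by (simp add: c residue_box_def)
  moreover have "u = c + (\<chi> i. (int q - 1) * (u $ i div (int q - 1)))"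
    by (simp add: c vec_eq_iff)
  ultimately show "c \<in> residue_box q \<and> (\<exists>b. (\<forall>i. int q - 1 dvd b $ i) \<and> u = c + b)"
    by (intro conjI exI[of _ "\<chi> i. (int q - 1) * (u $ i div (int q - 1))"]) auto
qed

lemma residue_rep_eq:
  "q \<ge> 2 \<Longrightarrow> residue_rep q u = (\<chi> i. u $ i mod (int q - 1))"
  by (simp add: residue_rep_def residue_rep_unique)

definition reduced_points :: "nat \<Rightarrow> (real ^ 'n) set \<Rightarrow> (int ^ 'n) set" where
  "reduced_points q P = {residue_rep q u | u. u \<in> lattice_points P}"

end

theory Submission
  imports Defs "HOL-Computational_Algebra.Polynomial"
begin

text \<open>
  The monomials are characters of the torus, and two of them agree iff their exponents agree modulo
  \<open>q - 1\<close>. By orthogonality, pairing the evaluation of \<open>f\<close> with the inverse of the character \<open>c\<close>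
  returns, up to the unit \<open>(q - 1) ^ r = (-1) ^ r\<close>, the sum of the coefficients of \<open>f\<close> over the
  residue class of \<open>c\<close>. So the monomials of distinct classes have linearly independent words, and
  \<open>f\<close> is in the kernel iff each of these class sums vanishes; moving every monomial of \<open>f\<close> to a
  chosen exponent of its class then writes \<open>f\<close> as a combination of differences \<open>\<chi>\<^sup>u - \<chi>\<^sup>u\<^sup>'\<close>.
\<close>

section \<open>Powers in a finite field\<close>

text \<open>Translation by 1 permutes the ring, so it leaves the sum of all elements unchanged while
  adding 1 once per element.\<close>

lemma of_nat_card_UNIV_eq_0: "of_nat CARD('a) = (0 :: 'a :: {ring_1, finite})"
proof -
  have "(\<Sum>x\<in>UNIV. x + 1) = (\<Sum>x\<in>UNIV. x :: 'a)"
    by (rule sum.reindex_bij_witness[of _ "\<lambda>x. x - 1" "\<lambda>x. x + 1"]) auto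
  then show ?thesis by (simp add: sum.distrib)
qed

lemma card_field_ge_2: "CARD('a :: {field, finite}) \<ge> 2"
proof -
  have "card {0, 1 :: 'a} \<le> CARD('a)" by (rule card_mono) auto
  then show ?thesis by simp
qed

text \<open>Multiplication by \<open>x\<close> permutes the nonzero elements; comparing their
  product before and after, and cancelling it, leaves the power of \<open>x\<close>.\<close>

lemma field_power_card_minus_1:
  fixes x :: "'a :: {field, finite}"
  assumes "x \<noteq> 0"
  shows "x ^ (CARD('a) - 1) = 1"
proof -
  have "(\<Prod>y\<in>UNIV - {0}. x * y) = (\<Prod>y\<in>UNIV - {0}. y)"
    by (rule prod.reindex_bij_witness[of _ "\<lambda>y. y / x" "\<lambda>y. x * y"]) (use assms in auto)
  moreover have "(\<Prod>y\<in>UNIV - {0}. y :: 'a) \<noteq> 0" by simp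
  ultimately show ?thesis by (simp add: prod.distrib card_Diff_singleton)
qed

lemma field_power_int_mod:
  fixes x :: "'a :: {field, finite}"
  assumes "x \<noteq> 0"
  shows "x powi (k mod (int CARD('a) - 1)) = x powi k"
proof -
  define m where "m = int CARD('a) - 1"
  have m: "m = int (CARD('a) - 1)"
    using card_field_ge_2[where 'a = 'a] by (simp add: m_def)
  have "x powi m = 1" unfolding m power_int_of_nat by (rule field_power_card_minus_1[OF assms])
  moreover have "x powi (m * (k div m) + k mod m) = (x powi m) powi (k div m) * x powi (k mod m)"
    using assms by (simp only: power_int_add power_int_mult simp_thms)
  ultimately have "x powi k = x powi (k mod m)" by simp
  then show ?thesis by (simp add: m_def)
qed

text \<open>Root counting stands in for cyclicity of the unit group: otherwise all
  \<open>CARD('a) - 1\<close> units would be roots of \<open>monom 1 n - 1\<close>, whose degree is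
  smaller.\<close>

lemma ex_power_int_neq_1:
  assumes "\<not> int CARD('a :: {field, finite}) - 1 dvd k"
  shows "\<exists>x :: 'a. x \<noteq> 0 \<and> x powi k \<noteq> 1"
proof (rule ccontr)
  assume asm: "\<not> ?thesis"
  define m where "m = int CARD('a) - 1"
  define n where "n = nat (k mod m)"
  have "m > 0" using card_field_ge_2[where 'a = 'a] by (simp add: m_def)
  then have "k mod m \<ge> 0" "k mod m < m" by simp_all
  moreover have "k mod m \<noteq> 0" using assms by (simp add: m_def dvd_eq_mod_eq_0)
  ultimately have n: "n > 0" "n < CARD('a) - 1" "k mod m = int n"
    by (auto simp: n_def m_def)
  let ?p = "monom 1 n - 1 :: 'a poly"
  have root: "poly ?p x = 0" if "x \<noteq> 0" for x
  proof -
    have "x powi k = 1" using asm that by blast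
    then show ?thesis
      using field_power_int_mod[OF that, of k] n(3) by (simp add: poly_monom m_def)
  qed
  \<comment> \<open>Positivity of \<open>n\<close> keeps the constant term from touching the leading
    one; it also makes \<open>?p\<close> nonzero for the root bound.\<close>
  have deg: "degree ?p = n"
    using n(1) degree_add_eq_left[of "- 1" "monom 1 n :: 'a poly"] by (simp add: degree_monom_eq)
  have "CARD('a) - 1 = card (UNIV - {0 :: 'a})" by (simp add: card_Diff_singleton)
  also have "\<dots> \<le> card {x. poly ?p x = 0}" using root by (intro card_mono) auto
  also have "\<dots> \<le> degree ?p" using deg n(1) by (intro card_poly_roots_bound) auto
  finally show False using deg n(2) by simp
qed

section \<open>Characters of the torus\<close>

lemma Rep_nonzero_neq_0 [simp]: "Rep_nonzero x \<noteq> 0"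
  using Rep_nonzero[of x] by simp

lemma monom_at_add: "monom_at (u + v) t = monom_at u t * monom_at v t"
  by (simp add: monom_at_def power_int_add prod.distrib)

lemma monom_at_0 [simp]: "monom_at 0 t = 1"
  by (simp add: monom_at_def)

lemma monom_at_residue_rep:
  fixes t :: "'a :: {field, finite} nonzero ^ 'n :: finite"
  shows "monom_at (residue_rep CARD('a) u) t = monom_at u t"
  by (simp add: monom_at_def residue_rep_eq card_field_ge_2 field_power_int_mod)

lemma residue_rep_idem:
  "q \<ge> 2 \<Longrightarrow> residue_rep q (residue_rep q u) = residue_rep q u"
  by (simp add: residue_rep_eq vec_eq_iff)

lemma residue_rep_eq_iff:
  "q \<ge> 2 \<Longrightarrow> residue_rep q u = residue_rep q v \<longleftrightarrow> (\<forall>i. int q - 1 dvd u $ i - v $ i)"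
  by (simp add: residue_rep_eq vec_eq_iff mod_eq_dvd_iff)

text \<open>The group law of the torus, written through \<open>Rep_nonzero\<close> and
  \<open>Abs_nonzero\<close> because \<open>nonzero\<close> is a bare subtype without a
  multiplication of its own.\<close>

definition torus_mult :: "'a :: field nonzero ^ 'n \<Rightarrow> 'a nonzero ^ 'n \<Rightarrow> 'a nonzero ^ 'n" where
  "torus_mult s t = (\<chi> i. Abs_nonzero (Rep_nonzero (s $ i) * Rep_nonzero (t $ i)))"

lemma Rep_torus_mult [simp]:
  "Rep_nonzero (torus_mult s t $ i) = Rep_nonzero (s $ i) * Rep_nonzero (t $ i)"
  by (simp add: torus_mult_def Abs_nonzero_inverse)

lemma monom_at_torus_mult: "monom_at u (torus_mult s t) = monom_at u s * monom_at u t"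
  by (simp add: monom_at_def power_int_mult_distrib prod.distrib)

lemma bij_torus_mult:
  fixes s :: "'a :: {field, finite} nonzero ^ 'n :: finite"
  shows "bij (torus_mult s)"
proof -
  have "inj (torus_mult s)"
  proof (rule injI)
    fix t t' assume eq: "torus_mult s t = torus_mult s t'"
    have "Rep_nonzero (t $ i) = Rep_nonzero (t' $ i)" for i
      using arg_cong[OF eq, of "\<lambda>x. Rep_nonzero (x $ i)"] by simp
    then show "t = t'" by (simp add: vec_eq_iff Rep_nonzero_inject)
  qed
  then show ?thesis by (simp add: bij_def finite_UNIV_inj_surj)
qed

text \<open>Translating by a point \<open>s\<close> where the character is not 1 preserves the sum,
  yet multiplies it by the value at \<open>s\<close>.\<close>

lemma sum_monom_at_eq_0:
  fixes u :: "int ^ 'n :: finite"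
  assumes "\<not> int CARD('a :: {field, finite}) - 1 dvd u $ j"
  shows "(\<Sum>t\<in>UNIV. monom_at u (t :: 'a nonzero ^ 'n)) = 0"
proof -
  obtain x :: 'a where x: "x \<noteq> 0" "x powi (u $ j) \<noteq> 1"
    using ex_power_int_neq_1[OF assms] by blast
  \<comment> \<open>All coordinates but \<open>j\<close> are 1, so the character takes the value
    \<open>x powi (u $ j)\<close> at \<open>s\<close>.\<close>
  define s :: "'a nonzero ^ 'n" where "s = (\<chi> i. Abs_nonzero (if i = j then x else 1))"
  have "monom_at u s = (\<Prod>i\<in>UNIV. if i = j then x powi (u $ j) else 1)"
    unfolding monom_at_def using x(1)
    by (intro prod.cong) (auto simp: s_def Abs_nonzero_inverse)
  then have s: "monom_at u s \<noteq> 1" using x(2) by simp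
  have "(\<Sum>t\<in>UNIV. monom_at u t) = (\<Sum>t\<in>UNIV. monom_at u (torus_mult s t))"
    using sum.reindex_bij_betw[OF bij_torus_mult, of "monom_at u" s] by simp
  also have "\<dots> = monom_at u s * (\<Sum>t\<in>UNIV. monom_at u t)"
    by (simp add: monom_at_torus_mult sum_distrib_left)
  finally show ?thesis using s by simp
qed

text \<open>Orthogonality, with \<open>monom_at (- v)\<close> as the inverse character. Within a
  class every summand is 1, and the order of the torus becomes a unit in the field because
  \<open>CARD('a)\<close> maps to 0.\<close>

lemma sum_monom_at_diff:
  fixes u v :: "int ^ 'n :: finite"
  shows "(\<Sum>t\<in>UNIV. monom_at u t * monom_at (- v) (t :: 'a :: {field, finite} nonzero ^ 'n))
    = (if residue_rep CARD('a) u = residue_rep CARD('a) v then (-1) ^ CARD('n) else 0)"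
proof (cases "residue_rep CARD('a) u = residue_rep CARD('a) v")
  case True
  have "monom_at u t * monom_at (- v) t = 1" for t :: "'a nonzero ^ 'n"
    using monom_at_residue_rep[of u t] monom_at_residue_rep[of v t] True
    by (simp flip: monom_at_add[of v "- v" t, simplified] monom_at_0)
  then have "(\<Sum>t\<in>UNIV. monom_at u t * monom_at (- v) (t :: 'a nonzero ^ 'n))
    = of_nat CARD('a nonzero ^ 'n)" by simp
  also have "\<dots> = (of_nat CARD('a) - 1) ^ CARD('n)"
    using card_field_ge_2[where 'a = 'a] by (simp add: card_torus of_nat_diff del: CARD_vec)
  also have "\<dots> = (-1 :: 'a) ^ CARD('n)" by (simp add: of_nat_card_UNIV_eq_0)
  finally show ?thesis using True by simp
next
  case False
  then obtain j where "\<not> int CARD('a) - 1 dvd (u - v) $ j"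
    by (auto simp: residue_rep_eq_iff card_field_ge_2)
  from sum_monom_at_eq_0[OF this] False show ?thesis
    by (simp flip: monom_at_add)
qed

section \<open>The evaluation map\<close>

text \<open>Allows sums and multiples, whose keys may shrink by cancellation, to be evaluated over
  one common index set.\<close>

lemma ev_eq_sum:
  assumes "finite A" "Poly_Mapping.keys f \<subseteq> A"
  shows "ev f = (\<chi> t. \<Sum>u\<in>A. Poly_Mapping.lookup f u * monom_at u t)"
  unfolding ev_def vec_eq_iff using assms
  by (auto intro!: sum.mono_neutral_left simp: in_keys_iff)

lemma linear_ev: "Vector_Spaces.linear lscale (*s) ev"
proof unfold_locales
  fix f g :: "('a, 'b) laurent"
  let ?A = "Poly_Mapping.keys f \<union> Poly_Mapping.keys g"
  have "Poly_Mapping.keys (f + g) \<subseteq> ?A" by (rule Poly_Mapping.keys_add)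
  then show "ev (f + g) = ev f + ev g"
    by (simp add: ev_eq_sum[of ?A] vec_eq_iff lookup_add algebra_simps sum.distrib)
next
  fix c and f :: "('a, 'b) laurent"
  have "Poly_Mapping.keys (lscale c f) \<subseteq> Poly_Mapping.keys f" by (auto simp: in_keys_iff)
  then show "ev (lscale c f) = c *s ev f"
    by (simp add: ev_eq_sum[of "Poly_Mapping.keys f"] vec_eq_iff sum_distrib_left mult.assoc)
qed

interpretation ev: Vector_Spaces.linear lscale "(*s)" ev
  by (rule linear_ev)

lemma ev_lmonom: "ev (lmonom u) = monom_word u"
  by (simp add: ev_def lmonom_def monom_word_def)

lemma monom_word_residue_rep:
  "monom_word (residue_rep CARD('a) u) = (monom_word u :: 'a :: {field, finite} ^ ('a nonzero ^ 'n :: finite))"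
  by (simp add: monom_word_def monom_at_residue_rep)

lemma toric_code_eq_span: "toric_code P = vec.span (monom_word ` lattice_points P)"
  by (simp add: toric_code_def sections_def ev.span_image[symmetric] image_image ev_lmonom)

text \<open>An unnormalised Fourier coefficient on the torus. The missing factor is a unit, and only
  vanishing matters below.\<close>

definition char_pairing ::
    "int ^ 'n \<Rightarrow> 'a :: {field, finite} ^ ('a nonzero ^ 'n :: finite) \<Rightarrow> 'a" where
  "char_pairing v x = (\<Sum>t\<in>UNIV. x $ t * monom_at (- v) t)"

lemma char_pairing_ev:
  fixes f :: "('a :: {field, finite}, 'n :: finite) laurent"
  shows "char_pairing v (ev f) = (-1) ^ CARD('n) *
    (\<Sum>u | u \<in> Poly_Mapping.keys f \<and> residue_rep CARD('a) u = residue_rep CARD('a) v.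
      Poly_Mapping.lookup f u)"
proof -
  have "char_pairing v (ev f) = (\<Sum>t\<in>UNIV. \<Sum>u\<in>Poly_Mapping.keys f.
      Poly_Mapping.lookup f u * (monom_at u t * monom_at (- v) t))"
    by (simp add: char_pairing_def ev_def sum_distrib_right mult.assoc)
  also have "\<dots> = (\<Sum>u\<in>Poly_Mapping.keys f. Poly_Mapping.lookup f u *
      (\<Sum>t\<in>UNIV. monom_at u t * monom_at (- v) (t :: 'a nonzero ^ 'n)))"
    by (subst sum.swap) (simp add: sum_distrib_left)
  also have "\<dots> = (\<Sum>u\<in>Poly_Mapping.keys f.
      if residue_rep CARD('a) u = residue_rep CARD('a) v
      then Poly_Mapping.lookup f u * (-1) ^ CARD('n) else 0)"
    by (intro sum.cong) (simp_all add: sum_monom_at_diff)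
  also have "\<dots> = (\<Sum>u | u \<in> Poly_Mapping.keys f \<and> residue_rep CARD('a) u = residue_rep CARD('a) v.
      Poly_Mapping.lookup f u * (-1) ^ CARD('n))"
    by (simp add: sum.inter_filter)
  finally show ?thesis by (simp add: sum_distrib_left mult.commute)
qed

lemma char_pairing_monom_word:
  "char_pairing v (monom_word u :: 'a :: {field, finite} ^ ('a nonzero ^ 'n :: finite))
    = (if residue_rep CARD('a) u = residue_rep CARD('a) v then (-1) ^ CARD('n) else 0)"
  by (simp add: char_pairing_def monom_word_def sum_monom_at_diff)

lemma subspace_char_pairing_eq_0: "vec.subspace {x. char_pairing v x = 0}"
  by (rule vec.subspaceI)
    (auto simp: char_pairing_def algebra_simps sum.distrib simp flip: sum_distrib_left)

text \<open>Pairing with \<open>v\<close> is nonzero on the word of \<open>v\<close>, and on the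
  word of \<open>u\<close> only if the classes agree.\<close>

lemma monom_word_eq_iff:
  "(monom_word u :: 'a :: {field, finite} ^ ('a nonzero ^ 'n :: finite)) = monom_word v
    \<longleftrightarrow> residue_rep CARD('a) u = residue_rep CARD('a) v"
proof
  assume "(monom_word u :: 'a ^ ('a nonzero ^ 'n)) = monom_word v"
  then have "char_pairing v (monom_word u :: 'a ^ ('a nonzero ^ 'n)) = char_pairing v (monom_word v)"
    by simp
  then show "residue_rep CARD('a) u = residue_rep CARD('a) v"
    by (simp add: char_pairing_monom_word split: if_splits)
qed (metis monom_word_residue_rep)

text \<open>The functional \<open>char_pairing v\<close> kills every word other than that of
  \<open>v\<close>. Exponents in \<open>A\<close> may share a class, since their words then coincide
  in the image.\<close>

lemma independent_monom_words:
  "vec.independent (monom_word ` A :: ('a :: {field, finite} ^ ('a nonzero ^ 'n :: finite)) set)"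
  unfolding vec.dependent_def
proof clarify
  fix v assume v: "monom_word v \<in> vec.span (monom_word ` A - {monom_word v :: 'a ^ ('a nonzero ^ 'n)})"
  have "monom_word ` A - {monom_word v :: 'a ^ ('a nonzero ^ 'n)} \<subseteq> {x. char_pairing v x = 0}"
    by (auto simp: char_pairing_monom_word monom_word_eq_iff)
  from vec.span_minimal[OF this subspace_char_pairing_eq_0] v
  have "char_pairing v (monom_word v :: 'a ^ ('a nonzero ^ 'n)) = 0" by auto
  then show False by (simp add: char_pairing_monom_word)
qed

section \<open>The kernel\<close>

lemma laurent_eq_sum_lmonom:
  "f = (\<Sum>u\<in>Poly_Mapping.keys f. lscale (Poly_Mapping.lookup f u) (lmonom u))"
  by (rule poly_mapping_eqI)
    (auto simp: lookup_sum lmonom_def lookup_single when_def in_keys_iff if_distrib sum.delta cong: if_cong)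

lemma kernel_ev_eq_span:
  fixes P :: "(real ^ 'n :: finite) set"
  shows "{f \<in> (sections P :: ('a :: {field, finite}, 'n) laurent set). ev f = 0}
    = laurent.span {lmonom u - lmonom u' | u u'. u \<in> lattice_points P \<and> u' \<in> lattice_points P
        \<and> residue_rep CARD('a) u = residue_rep CARD('a) u'}" (is "?K = laurent.span ?S")
proof (intro equalityI subsetI)
  have "laurent.subspace ?K"
    unfolding sections_def by (rule laurent.subspaceI)
      (auto simp: ev.add ev.scale intro: laurent.span_zero laurent.span_add laurent.span_scale)
  moreover have "?S \<subseteq> ?K"
    unfolding sections_def
    by (auto simp: ev.diff ev_lmonom monom_word_eq_iff intro!: laurent.span_diff[OF laurent.span_base laurent.span_base])
  ultimately show "f \<in> ?K" if "f \<in> laurent.span ?S" for f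
    using laurent.span_minimal that by blast
next
  fix f assume "f \<in> ?K"
  then have keys: "Poly_Mapping.keys f \<subseteq> lattice_points P" and ev0: "ev f = 0"
    by (auto simp: sections_eq)
  let ?R = "residue_rep CARD('a) :: int ^ 'n \<Rightarrow> int ^ 'n"
  let ?a = "Poly_Mapping.lookup f"
  \<comment> \<open>The reduced exponent may lie outside \<open>P\<close>, so each class is
    represented by one of its members in \<open>P\<close>; only then are the differences below
    generators.\<close>
  define rep where "rep c = (SOME u. u \<in> lattice_points P \<and> ?R u = c)" for c
  have rep: "rep (?R u) \<in> lattice_points P \<and> ?R (rep (?R u)) = ?R u" if "u \<in> lattice_points P" for u
    unfolding rep_def by (rule someI[of _ u]) (use that in simp)
  have class_sum: "(\<Sum>u | u \<in> Poly_Mapping.keys f \<and> ?R u = c. ?a u) = 0"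
    if "c \<in> ?R ` Poly_Mapping.keys f" for c
    using that char_pairing_ev[of _ f] by (auto simp: ev0 char_pairing_def)
  \<comment> \<open>Grouped by class, the monomial is constant and its coefficient is a vanishing
    class sum. The whole sum is therefore 0 and may be subtracted from \<open>f\<close>.\<close>
  have "(\<Sum>u\<in>Poly_Mapping.keys f. lscale (?a u) (lmonom (rep (?R u))))
      = (\<Sum>c\<in>?R ` Poly_Mapping.keys f. \<Sum>u | u \<in> Poly_Mapping.keys f \<and> ?R u = c.
          lscale (?a u) (lmonom (rep (?R u))))"
    by (rule sum.image_gen) simp
  also have "\<dots> = (\<Sum>c\<in>?R ` Poly_Mapping.keys f.
      lscale (\<Sum>u | u \<in> Poly_Mapping.keys f \<and> ?R u = c. ?a u) (lmonom (rep c)))"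
    by (intro sum.cong) (auto simp: laurent.scale_sum_left)
  also have "\<dots> = 0" by (intro sum.neutral ballI) (simp add: class_sum)
  finally have "f = (\<Sum>u\<in>Poly_Mapping.keys f. lscale (?a u) (lmonom u - lmonom (rep (?R u))))"
    by (subst laurent_eq_sum_lmonom) (simp add: laurent.scale_right_diff_distrib sum_subtractf)
  moreover have "lmonom u - lmonom (rep (?R u)) \<in> ?S" if "u \<in> Poly_Mapping.keys f" for u
    using rep[of u] keys that by fastforce
  then have "(\<Sum>u\<in>Poly_Mapping.keys f. lscale (?a u) (lmonom u - lmonom (rep (?R u)))) \<in> laurent.span ?S"
    by (intro laurent.span_sum laurent.span_scale laurent.span_base)
  ultimately show "f \<in> laurent.span ?S" by simp
qed

theorem theorem3p3:
  fixes P :: "(real ^ 'n :: finite) set" and q :: nat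
  assumes "q = CARD('a :: {field, finite})"
    and "CARD('n) \<ge> 2"
    and "lattice_polytope P"
    and "aff_dim P = int CARD('n)"
  shows "{f \<in> (sections P :: ('a, 'n) laurent set). ev f = 0}
        = laurent.span {lmonom u - lmonom u' | u u'.
            u \<in> lattice_points P \<and> u' \<in> lattice_points P \<and> residue_rep q u = residue_rep q u'}
    \<and> (let B = {monom_word (residue_rep q u) :: 'a ^ ('a nonzero ^ 'n) | u. u \<in> lattice_points P};
           C = toric_code P :: ('a ^ ('a nonzero ^ 'n)) set
       in B = {monom_word u | u. u \<in> reduced_points q P}
        \<and> vec.independent B \<and> vec.span B = C
        \<and> vec.dim C = card {residue_rep q u | u. u \<in> lattice_points P}
        \<and> vec.dim C = card (reduced_points q P))"
proof -
  have q: "q \<ge> 2" using assms(1) card_field_ge_2[where 'a = 'a] by simp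
  define B where "B = {monom_word (residue_rep q u) :: 'a ^ ('a nonzero ^ 'n) | u. u \<in> lattice_points P}"
  \<comment> \<open>Of the two descriptions of \<open>B\<close>, the one by reduced exponents serves
    for counting, the one by lattice points for the span.\<close>
  have B_reduced: "B = monom_word ` reduced_points q P"
    by (auto simp: B_def reduced_points_def)
  have B_lattice: "B = monom_word ` lattice_points P"
    by (auto simp: B_def assms(1) monom_word_residue_rep)
  have ind: "vec.independent B" unfolding B_lattice by (rule independent_monom_words)
  have span: "vec.span B = toric_code P" by (simp add: B_lattice toric_code_eq_span)
  \<comment> \<open>Reduced exponents are their own representatives, so distinct ones give distinct
    words and no element is lost in passing to \<open>B\<close>.\<close>
  have "inj_on (monom_word :: _ \<Rightarrow> 'a ^ ('a nonzero ^ 'n)) (reduced_points q P)"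
    using q by (auto simp: inj_on_def reduced_points_def monom_word_eq_iff residue_rep_idem
        simp flip: assms(1))
  then have "card B = card (reduced_points q P)" by (simp add: B_reduced card_image)
  then have dim: "vec.dim (toric_code P :: ('a ^ ('a nonzero ^ 'n)) set) = card (reduced_points q P)"
    using ind by (simp flip: span add: vec.dim_eq_card_independent)
  show ?thesis
    unfolding Let_def B_def[symmetric]
    using kernel_ev_eq_span[where 'a = 'a and P = P] B_reduced ind span dim
    by (simp add: assms(1) reduced_points_def image_def) blast
qed

end
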